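(* Let $m_1\ge m_2\ge m_3>0$, $\theta:=m_3$, $m=m_1+m_2+m_3$, and consider a sufficiently smooth pair $$\{H_E,H_F\}=\left\{\begin{bmatrix}I_{m_1}&0&0\\ 0&I_{m_2}&0\\ 0&0&0\end{bmatrix},\begin{bmatrix}H_{11}&H_{12}&H_{13}\\ [I_{m_2}\ \ 0]&H_{22}&0\\ 0&H_{32}&0\end{bmatrix}\right\},\qquad H_{ij}:\mathcal I\to\mathbb{R}^{m_i\times m_j},$$ where $[I_{m_2}\ \ 0]\in\mathbb{R}^{m_2\times m_1}$ and $H_{32}(t)[I_{m_2}\ \ 0]H_{13}(t)$ is nonsingular for all $t\in\mathcal I$. Let $B_{d,3}:\mathcal I\to\mathbb{R}^{m_2\times(m_2-\theta)}$ and $B_{a,3}:\mathcal I\to\mathbb{R}^{m_2\times\theta}$ be sufficiently smooth matrix functions whose columns are pointwise orthonormal bases of $\ker H_{32}$ and of $(\ker H_{32})^\perp$, respectively, and put $$B_{d,2}=\begin{bmatrix}B_{d,3}&0\\ 0&I_{m_1-m_2}\end{bmatrix}\in\mathbb{R}^{m_1\times(m_1-\theta)},\quad B_{a,2}=\begin{bmatrix}B_{a,3}\\ 0\end{bmatrix}\in\mathbb{R}^{m_1\times\theta},$$ $$L_0=\begin{bmatrix}B_{d,2}^T&0&0\\ 0&B_{d,3}^T&0\\ B_{a,2}^T&0&0\\ 0&B_{a,3}^T&0\\ 0&0&I_{m_3}\end{bmatrix},\qquad K_0=\begin{bmatrix}B_{d,2}&0&0&B_{a,2}&0\\ 0&B_{d,3}&0&0&B_{a,3}\\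 0&0&I_{m_3}&0&0\end{bmatrix}.$$ Then, with $d=m_1+m_2-2m_3=m-3\theta$ and $a=3\theta$, $$L_0H_EK_0=\begin{bmatrix}I_d&0\\ 0&N^{(E)}\end{bmatrix},\qquad N^{(E)}=\begin{bmatrix}0&I_\theta&0\\ 0&0&I_\theta\\ 0&0&0\end{bmatrix},$$ and the pair $\{E_0,F_0\}$ with $E_0=L_0H_EK_0$, $F_0=L_0H_FK_0+L_0H_EK_0'=\begin{bmatrix}F_{11}&F_{12}\\ F_{21}&F_{22}\end{bmatrix}$ is in PreSCF (with three blocks of size $\theta$), where $F_{22}$ is block upper triangular with pointwise nonsingular diagonal blocks $B_{a,2}^TH_{13}$, $I_\theta$ and $H_{32}B_{a,3}$.
   Context: $\mathcal I\subseteq\mathbb{R}$ is an interval; all matrix functions are real and defined on $\mathcal I$; $'$ is differentiation in $t$. The matrix $F_0$ is partitioned so that $F_{11}$ is $d\times d$ and $F_{22}$ is $a\times a$; $a\times a$ matrix functions are partitioned into $3\times 3$ blocks of size $\theta\times\theta$. For $m_1=m_2$, $[I_{m_2}\ \ 0]$ means $I_{m_2}$. PreSCF: the pair $\left\{\begin{bmatrix} I_d&0\\ 0&N^{(E)}\end{bmatrix},\begin{bmatrix}F_{11}&F_{12}\\ F_{21}&F_{22}\end{bmatrix}\right\}$ is in PreSCF if $F_{22}$ and $F_{21}F_{12}$ are block upper triangular with the same block sizes as $N^{(E)}$ and $F_{22}$ is pointwise nonsingular. *)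

theory Defs
  imports
    "HOL-Analysis.Derivative"
    "Jordan_Normal_Form.Matrix_Kernel"
begin

(* Matrices are those of Jordan_Normal_Form, whose dimensions are natural numbers. A matrix
   function is a map real => real mat; only its values on the interval are relevant. *)

(* All derivatives are relative to the interval, hence one-sided at end points that belong to it. *)

primrec Ck_on :: "nat \<Rightarrow> real set \<Rightarrow> (real \<Rightarrow> real) \<Rightarrow> bool" where
  "Ck_on 0 I f \<longleftrightarrow> continuous_on I f"
| "Ck_on (Suc k) I f \<longleftrightarrow>
     (\<exists>f'. (\<forall>t\<in>I. (f has_real_derivative f' t) (at t within I)) \<and> Ck_on k I f')"

definition mat_Ck_on :: "nat \<Rightarrow> real set \<Rightarrow> nat \<Rightarrow> nat \<Rightarrow> (real \<Rightarrow> real mat) \<Rightarrow> bool" where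
  "mat_Ck_on k I r c A \<longleftrightarrow>
     (\<forall>t\<in>I. A t \<in> carrier_mat r c) \<and>
     (\<forall>i<r. \<forall>j<c. Ck_on k I (\<lambda>t. A t $$ (i, j)))"

definition mat_deriv :: "real set \<Rightarrow> (real \<Rightarrow> real mat) \<Rightarrow> real \<Rightarrow> real mat" where
  "mat_deriv I A t = mat (dim_row (A t)) (dim_col (A t))
     (\<lambda>(i, j). vector_derivative (\<lambda>s. A s $$ (i, j)) (at t within I))"

definition orthonormal_basis_cols :: "nat \<Rightarrow> nat \<Rightarrow> real mat \<Rightarrow> real vec set \<Rightarrow> bool" where
  "orthonormal_basis_cols n r B W \<longleftrightarrow>
     B \<in> carrier_mat n r \<and>
     (\<forall>i<r. \<forall>j<r. scalar_prod (col B i) (col B j) = (if i = j then 1 else 0)) \<and>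
     vec_space.col_space n B = W"

definition append_cols :: "'a::zero mat \<Rightarrow> 'a mat \<Rightarrow> 'a mat" (infixr \<open>@\<^sub>c\<close> 70) where
  "A @\<^sub>c B = four_block_mat A B (0\<^sub>m 0 (dim_col A)) (0\<^sub>m 0 (dim_col B))"

(* Block indices start at 0. *)
definition block :: "nat \<Rightarrow> nat \<Rightarrow> nat \<Rightarrow> 'a mat \<Rightarrow> 'a mat" where
  "block \<theta> p q A = mat \<theta> \<theta> (\<lambda>(i, j). A $$ (p * \<theta> + i, q * \<theta> + j))"

definition block_upper_triangular :: "nat \<Rightarrow> real mat \<Rightarrow> bool" where
  "block_upper_triangular \<theta> A \<longleftrightarrow>
     A \<in> carrier_mat (3 * \<theta>) (3 * \<theta>) \<and> (\<forall>p<3. \<forall>q<p. block \<theta> p q A = 0\<^sub>m \<theta> \<theta>)"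

definition N_E :: "nat \<Rightarrow> real mat" where
  "N_E \<theta> =
      0\<^sub>m \<theta> \<theta> @\<^sub>c 1\<^sub>m \<theta>   @\<^sub>c 0\<^sub>m \<theta> \<theta>
   @\<^sub>r 0\<^sub>m \<theta> \<theta> @\<^sub>c 0\<^sub>m \<theta> \<theta> @\<^sub>c 1\<^sub>m \<theta>
   @\<^sub>r 0\<^sub>m \<theta> \<theta> @\<^sub>c 0\<^sub>m \<theta> \<theta> @\<^sub>c 0\<^sub>m \<theta> \<theta>"

definition PreSCF ::
  "real set \<Rightarrow> nat \<Rightarrow> nat \<Rightarrow> (real \<Rightarrow> real mat) \<Rightarrow> (real \<Rightarrow> real mat) \<Rightarrow> bool" where
  "PreSCF I d \<theta> E F \<longleftrightarrow>
     (\<forall>t\<in>I.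
        E t = four_block_mat (1\<^sub>m d) (0\<^sub>m d (3 * \<theta>)) (0\<^sub>m (3 * \<theta>) d) (N_E \<theta>) \<and>
        F t \<in> carrier_mat (d + 3 * \<theta>) (d + 3 * \<theta>) \<and>
        (let (F11, F12, F21, F22) = split_block (F t) d d in
           block_upper_triangular \<theta> F22 \<and>
           block_upper_triangular \<theta> (F21 * F12) \<and>
           invertible_mat F22))"

(* The block [I 0] with m2 rows and m1 >= m2 columns. *)
definition I_0 :: "nat \<Rightarrow> nat \<Rightarrow> real mat" where
  "I_0 m2 m1 = 1\<^sub>m m2 @\<^sub>c 0\<^sub>m m2 (m1 - m2)"

definition H_E :: "nat \<Rightarrow> nat \<Rightarrow> nat \<Rightarrow> real mat" where
  "H_E m1 m2 m3 =
      1\<^sub>m m1    @\<^sub>c 0\<^sub>m m1 m2 @\<^sub>c 0\<^sub>m m1 m3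
   @\<^sub>r 0\<^sub>m m2 m1 @\<^sub>c 1\<^sub>m m2    @\<^sub>c 0\<^sub>m m2 m3
   @\<^sub>r 0\<^sub>m m3 m1 @\<^sub>c 0\<^sub>m m3 m2 @\<^sub>c 0\<^sub>m m3 m3"

definition H_F ::
  "nat \<Rightarrow> nat \<Rightarrow> nat \<Rightarrow> real mat \<Rightarrow> real mat \<Rightarrow> real mat \<Rightarrow> real mat \<Rightarrow> real mat \<Rightarrow> real mat" where
  "H_F m1 m2 m3 H11 H12 H13 H22 H32 =
      H11       @\<^sub>c H12 @\<^sub>c H13
   @\<^sub>r I_0 m2 m1 @\<^sub>c H22 @\<^sub>c 0\<^sub>m m2 m3
   @\<^sub>r 0\<^sub>m m3 m1 @\<^sub>c H32 @\<^sub>c 0\<^sub>m m3 m3"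

definition B_d2 :: "nat \<Rightarrow> nat \<Rightarrow> nat \<Rightarrow> real mat \<Rightarrow> real mat" where
  "B_d2 m1 m2 \<theta> Bd3 =
      Bd3                    @\<^sub>c 0\<^sub>m m2 (m1 - m2)
   @\<^sub>r 0\<^sub>m (m1 - m2) (m2 - \<theta>) @\<^sub>c 1\<^sub>m (m1 - m2)"

definition B_a2 :: "nat \<Rightarrow> nat \<Rightarrow> nat \<Rightarrow> real mat \<Rightarrow> real mat" where
  "B_a2 m1 m2 \<theta> Ba3 = Ba3 @\<^sub>r 0\<^sub>m (m1 - m2) \<theta>"

definition L_0 :: "nat \<Rightarrow> nat \<Rightarrow> nat \<Rightarrow> real mat \<Rightarrow> real mat \<Rightarrow> real mat" where
  "L_0 m1 m2 m3 Bd3 Ba3 =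
     (let \<theta> = m3; Bd2 = B_d2 m1 m2 \<theta> Bd3; Ba2 = B_a2 m1 m2 \<theta> Ba3 in
         transpose_mat Bd2  @\<^sub>c 0\<^sub>m (m1 - \<theta>) m2   @\<^sub>c 0\<^sub>m (m1 - \<theta>) m3
      @\<^sub>r 0\<^sub>m (m2 - \<theta>) m1   @\<^sub>c transpose_mat Bd3  @\<^sub>c 0\<^sub>m (m2 - \<theta>) m3
      @\<^sub>r transpose_mat Ba2  @\<^sub>c 0\<^sub>m \<theta> m2          @\<^sub>c 0\<^sub>m \<theta> m3
      @\<^sub>r 0\<^sub>m \<theta> m1          @\<^sub>c transpose_mat Ba3  @\<^sub>c 0\<^sub>m \<theta> m3
      @\<^sub>r 0\<^sub>m m3 m1         @\<^sub>c 0\<^sub>m m3 m2         @\<^sub>c 1\<^sub>m m3)"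

definition K_0 :: "nat \<Rightarrow> nat \<Rightarrow> nat \<Rightarrow> real mat \<Rightarrow> real mat \<Rightarrow> real mat" where
  "K_0 m1 m2 m3 Bd3 Ba3 =
     (let \<theta> = m3; Bd2 = B_d2 m1 m2 \<theta> Bd3; Ba2 = B_a2 m1 m2 \<theta> Ba3 in
         Bd2              @\<^sub>c 0\<^sub>m m1 (m2 - \<theta>) @\<^sub>c 0\<^sub>m m1 m3 @\<^sub>c Ba2      @\<^sub>c 0\<^sub>m m1 \<theta>
      @\<^sub>r 0\<^sub>m m2 (m1 - \<theta>) @\<^sub>c Bd3              @\<^sub>c 0\<^sub>m m2 m3 @\<^sub>c 0\<^sub>m m2 \<theta> @\<^sub>c Ba3
      @\<^sub>r 0\<^sub>m m3 (m1 - \<theta>) @\<^sub>c 0\<^sub>m m3 (m2 - \<theta>) @\<^sub>c 1\<^sub>m m3    @\<^sub>c 0\<^sub>m m3 \<theta> @\<^sub>c 0\<^sub>m m3 \<theta>)"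

end

(* Each strip of L_0 and K_0 meets only few blocks of H_E and H_F, so all blocks of E_0 and F_0 can
   be read off; the derivative K_0' has the zero pattern of K_0, and its contribution vanishes in
   every position where triangularity needs a zero. Completeness of the orthonormal system,
   B_d3 B_d3^T + B_a3 B_a3^T = I, together with H_32 B_d3 = 0 and [I 0]^T B_a3 = B_a2, gives
   H_32 [I 0] H_13 = (H_32 B_a3) (B_a2^T H_13). Hence both square factors are nonsingular. *)

theory Submission
  imports Defs
begin

section \<open>Algebra of matrices joined by rows and by columns\<close>

lemma dim_append_cols [simp]:
  "dim_row (A @\<^sub>c B) = dim_row A" "dim_col (A @\<^sub>c B) = dim_col A + dim_col B"
  by (simp_all add: append_cols_def)

lemma dim_append_rows [simp]:
  "dim_row (A @\<^sub>r B) = dim_row A + dim_row B" "dim_col (A @\<^sub>r B) = dim_col A"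
  by (simp_all add: append_rows_def)

lemma index_append_cols:
  assumes "dim_row A = dim_row B" "i < dim_row A" "j < dim_col A + dim_col B"
  shows "(A @\<^sub>c B) $$ (i, j) = (if j < dim_col A then A $$ (i, j) else B $$ (i, j - dim_col A))"
  using assms by (simp add: append_cols_def)

lemma index_append_rows:
  assumes "dim_col A = dim_col B" "i < dim_row A + dim_row B" "j < dim_col A"
  shows "(A @\<^sub>r B) $$ (i, j) = (if i < dim_row A then A $$ (i, j) else B $$ (i - dim_row A, j))"
  using assms by (simp add: append_rows_def)

lemma append_rows_mult:
  assumes "dim_col A = dim_col B" "dim_col A = dim_row C"
  shows "(A @\<^sub>r B) * C = (A * C) @\<^sub>r (B * C)"
  using assms by (intro eq_matI) (auto simp: index_append_rows scalar_prod_def)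

lemma mult_append_cols:
  assumes "dim_row B = dim_row C" "dim_col A = dim_row B"
  shows "A * (B @\<^sub>c C) = (A * B) @\<^sub>c (A * C)"
  using assms by (intro eq_matI) (auto simp: index_append_cols scalar_prod_def)

text \<open>The inner index runs first over the columns of \<open>A\<close> and then over those of
  \<open>B\<close>; cutting the sum between the two leaves one product for each pair.\<close>

lemma append_cols_mult_append_rows:
  fixes A B C D :: "'a::semiring_0 mat"
  assumes "dim_row A = dim_row B" "dim_col C = dim_col D"
    "dim_col A = dim_row C" "dim_col B = dim_row D"
  shows "(A @\<^sub>c B) * (C @\<^sub>r D) = A * C + B * D"
proof (intro eq_matI)
  fix i j assume "i < dim_row (A * C + B * D)" "j < dim_col (A * C + B * D)"
  then have ij: "i < dim_row A" "j < dim_col C" using assms by auto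
  have "((A @\<^sub>c B) * (C @\<^sub>r D)) $$ (i, j)
      = (\<Sum>k\<in>{0..<dim_row C + dim_row D}. (A @\<^sub>c B) $$ (i, k) * (C @\<^sub>r D) $$ (k, j))"
    using assms ij by (simp add: scalar_prod_def)
  also have "\<dots> = (\<Sum>k = 0..<dim_row C. A $$ (i, k) * C $$ (k, j))
      + (\<Sum>k = dim_row C..<dim_row C + dim_row D. B $$ (i, k - dim_row C) * D $$ (k - dim_row C, j))"
    using assms ij
    by (subst sum.atLeastLessThan_concat [symmetric, of 0 "dim_row C"])
       (auto intro!: arg_cong2[of _ _ _ _ "(+)"] sum.cong simp: index_append_cols index_append_rows)
  also have "(\<Sum>k = dim_row C..<dim_row C + dim_row D. B $$ (i, k - dim_row C) * D $$ (k - dim_row C, j))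
      = (\<Sum>k = 0..<dim_row D. B $$ (i, k) * D $$ (k, j))"
    by (rule sum.reindex_bij_witness[of _ "\<lambda>k. k + dim_row C" "\<lambda>k. k - dim_row C"]) auto
  finally show "((A @\<^sub>c B) * (C @\<^sub>r D)) $$ (i, j) = (A * C + B * D) $$ (i, j)"
    using assms ij by (simp add: scalar_prod_def)
qed (use assms in auto)

lemma append_cols_add:
  assumes "dim_col A = dim_col C" "dim_col B = dim_col D"
    "dim_row A = dim_row B" "dim_row C = dim_row D" "dim_row A = dim_row C"
  shows "(A @\<^sub>c B) + (C @\<^sub>c D) = (A + C) @\<^sub>c (B + D)"
  using assms by (intro eq_matI) (auto simp: index_append_cols)

lemma append_rows_add:
  assumes "dim_row A = dim_row C" "dim_row B = dim_row D"
    "dim_col A = dim_col B" "dim_col C = dim_col D" "dim_col A = dim_col C"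
  shows "(A @\<^sub>r B) + (C @\<^sub>r D) = (A + C) @\<^sub>r (B + D)"
  using assms by (intro eq_matI) (auto simp: index_append_rows)

lemma transpose_append_cols:
  "dim_row A = dim_row B \<Longrightarrow> (A @\<^sub>c B)\<^sup>T = A\<^sup>T @\<^sub>r B\<^sup>T"
  by (intro eq_matI) (auto simp: index_append_cols index_append_rows)

lemma transpose_append_rows:
  "dim_col A = dim_col B \<Longrightarrow> (A @\<^sub>r B)\<^sup>T = A\<^sup>T @\<^sub>c B\<^sup>T"
  by (intro eq_matI) (auto simp: index_append_cols index_append_rows)

lemma one_append:
  "1\<^sub>m (p + q) = (1\<^sub>m p @\<^sub>c 0\<^sub>m p q) @\<^sub>r (0\<^sub>m q p @\<^sub>c 1\<^sub>m q)"
  by (intro eq_matI) (auto simp: index_append_cols index_append_rows)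

lemma zero_append_rows: "0\<^sub>m p q @\<^sub>r 0\<^sub>m r q = 0\<^sub>m (p + r) q"
  by (intro eq_matI) (auto simp: index_append_cols index_append_rows)

lemma zero_append_cols: "0\<^sub>m p q @\<^sub>c 0\<^sub>m p r = 0\<^sub>m p (q + r)"
  by (intro eq_matI) (auto simp: index_append_cols index_append_rows)

lemma zero_mult: "dim_row A = n \<Longrightarrow> 0\<^sub>m r n * A = 0\<^sub>m r (dim_col A)"
  by (intro eq_matI) (auto simp: scalar_prod_def)

lemma mult_zero: "dim_col A = n \<Longrightarrow> A * 0\<^sub>m n c = 0\<^sub>m (dim_row A) c"
  by (intro eq_matI) (auto simp: scalar_prod_def)

lemma add_zero:
  fixes A :: "'a::monoid_add mat"
  assumes "dim_row A = r" "dim_col A = c"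
  shows "A + 0\<^sub>m r c = A" "0\<^sub>m r c + A = A"
  using assms by (auto intro!: eq_matI)

lemma mult_mat_assoc:
  fixes A B C :: "'a::semiring_0 mat"
  assumes "dim_col A = dim_row B" "dim_col B = dim_row C"
  shows "A * B * C = A * (B * C)"
  using assms by (intro assoc_mult_mat[of _ "dim_row A" _ _ "dim_col B" _ "dim_col C"]) auto

text \<open>As rewrite rules these carry a product of block matrices to the matrix of block products
  and delete terms with a zero factor, so later block computations need no indices.\<close>

lemmas block_algebra = append_rows_mult mult_append_cols append_cols_mult_append_rows
  append_cols_add append_rows_add zero_mult mult_zero add_zero


lemma append_cols_append_rows:
  assumes "dim_col A = dim_col B" "dim_col C = dim_col D"
    "dim_row A = dim_row C" "dim_row B = dim_row D"
  shows "(A @\<^sub>r B) @\<^sub>c (C @\<^sub>r D) = (A @\<^sub>c C) @\<^sub>r (B @\<^sub>c D)"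
  using assms by (intro eq_matI) (auto simp: index_append_cols index_append_rows)

lemma append_cols_assoc:
  assumes "dim_row A = dim_row B" "dim_row B = dim_row C"
  shows "(A @\<^sub>c B) @\<^sub>c C = A @\<^sub>c B @\<^sub>c C"
  using assms by (intro eq_matI) (auto simp: index_append_cols diff_diff_eq)

lemma append_rows_assoc:
  assumes "dim_col A = dim_col B" "dim_col B = dim_col C"
  shows "(A @\<^sub>r B) @\<^sub>r C = A @\<^sub>r B @\<^sub>r C"
  using assms by (intro eq_matI) (auto simp: index_append_rows diff_diff_eq)

lemma four_block_mat_append:
  assumes "dim_row A = dim_row B" "dim_row C = dim_row D" "dim_col A = dim_col C" "dim_col B = dim_col D"
  shows "four_block_mat A B C D = (A @\<^sub>c B) @\<^sub>r (C @\<^sub>c D)"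
  using assms by (intro eq_matI) (auto simp: index_append_cols index_append_rows)

lemma split_block_four_block_mat:
  assumes "A \<in> carrier_mat r c" "dim_row B = r" "dim_col C = c" "dim_row C = dim_row D" "dim_col B = dim_col D"
  shows "split_block (four_block_mat A B C D) r c = (A, B, C, D)"
  using assms by (auto simp: split_block_def Let_def)

text \<open>The blocks on and below the diagonal suffice: triangularity concerns those below it, and
  nonsingularity those on it.\<close>

lemma block_append:
  fixes A00 :: "'a::zero mat"
  assumes "A00 \<in> carrier_mat n n" "A01 \<in> carrier_mat n n" "A02 \<in> carrier_mat n n"
    "A10 \<in> carrier_mat n n" "A11 \<in> carrier_mat n n" "A12 \<in> carrier_mat n n"
    "A20 \<in> carrier_mat n n" "A21 \<in> carrier_mat n n" "A22 \<in> carrier_mat n n"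
  defines "A \<equiv> A00 @\<^sub>c A01 @\<^sub>c A02 @\<^sub>r A10 @\<^sub>c A11 @\<^sub>c A12 @\<^sub>r A20 @\<^sub>c A21 @\<^sub>c A22"
  shows "block n 0 0 A = A00" "block n 1 0 A = A10" "block n 1 1 A = A11"
    "block n 2 0 A = A20" "block n 2 1 A = A21" "block n 2 2 A = A22"
  using assms
  by (auto intro!: eq_matI simp: block_def index_append_cols index_append_rows)

section \<open>Invertibility and determinants of block triangular matrices\<close>

lemma invertible_mat_iff_det:
  fixes A :: "'a::field mat"
  assumes A: "A \<in> carrier_mat n n"
  shows "invertible_mat A \<longleftrightarrow> det A \<noteq> 0"
proof
  assume "invertible_mat A"
  then obtain B where AB: "A * B = 1\<^sub>m n" and BA: "B * A = 1\<^sub>m (dim_row B)"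
    using A by (auto simp: invertible_mat_def inverts_mat_def)
  \<comment> \<open>\<open>invertible_mat\<close> does not fix the shape of the inverse; counting
    columns on both sides of the two inverse equations shows that it is square of order
    \<open>n\<close>.\<close>
  have "dim_col B = n" using AB by (metis index_mult_mat(3) index_one_mat(3))
  moreover have "dim_row B = n" using A BA by (metis carrier_matD(2) index_mult_mat(3) index_one_mat(3))
  ultimately have "B \<in> carrier_mat n n" by auto
  then have "det A * det B = 1" using det_mult[OF A] AB by (metis det_one)
  then show "det A \<noteq> 0" by auto
next
  assume "det A \<noteq> 0"
  \<comment> \<open>\<open>undefined\<close> fills the record extension of \<open>ring_mat\<close>,
    which has no influence on its units.\<close>
  from det_non_zero_imp_unit[OF A this, of undefined]
  obtain B where "B \<in> carrier_mat n n" "A * B = 1\<^sub>m n" "B * A = 1\<^sub>m n"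
    by (auto simp: Units_def ring_mat_def)
  then show "invertible_mat A"
    using A by (auto simp: invertible_mat_def inverts_mat_def)
qed

text \<open>Grouping the last two block rows and columns gives a two-by-two block triangular matrix
  whose lower corner is again of that kind, so the two-block formula applies twice.\<close>

lemma det_block_upper_triangular:
  fixes A B C D E G :: "'a::idom mat"
  assumes "A \<in> carrier_mat n n" "B \<in> carrier_mat n n" "C \<in> carrier_mat n n"
    "D \<in> carrier_mat n n" "E \<in> carrier_mat n n" "G \<in> carrier_mat n n"
  shows "det (A @\<^sub>c B @\<^sub>c C @\<^sub>r 0\<^sub>m n n @\<^sub>c D @\<^sub>c E @\<^sub>r 0\<^sub>m n n @\<^sub>c 0\<^sub>m n n @\<^sub>c G)
    = det A * det D * det G"
proof -
  let ?DG = "four_block_mat D E (0\<^sub>m n n) G"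
  have "A @\<^sub>c B @\<^sub>c C @\<^sub>r 0\<^sub>m n n @\<^sub>c D @\<^sub>c E @\<^sub>r 0\<^sub>m n n @\<^sub>c 0\<^sub>m n n @\<^sub>c G
    = four_block_mat A (B @\<^sub>c C) (0\<^sub>m (n + n) n) ?DG"
    using assms
    by (simp add: four_block_mat_append append_cols_append_rows flip: zero_append_rows)
  also have "det \<dots> = det A * det ?DG"
    using assms by (intro det_four_block_mat_lower_left_zero[of _ n _ "n + n"]) auto
  also have "det ?DG = det D * det G"
    using assms by (intro det_four_block_mat_lower_left_zero[of _ n _ n]) auto
  finally show ?thesis by (simp add: mult.assoc)
qed

section \<open>Blockwise differentiation relative to an interval\<close>

lemma vector_derivative_cong_on:
  assumes "t \<in> S" "\<And>s. s \<in> S \<Longrightarrow> f s = g s"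
  shows "vector_derivative f (at t within S) = vector_derivative g (at t within S)"
proof -
  \<comment> \<open>\<open>vector_derivative\<close> is a choice among all derivatives. The same
    values \<open>D\<close> qualify for \<open>f\<close> and \<open>g\<close>, so the choices
    coincide even where no derivative exists.\<close>
  have "(f has_vector_derivative D) (at t within S) \<longleftrightarrow> (g has_vector_derivative D) (at t within S)" for D
    using assms by (metis has_vector_derivative_transform)
  then show ?thesis by (simp add: vector_derivative_def)
qed

lemma dim_mat_deriv [simp]:
  "dim_row (mat_deriv I A t) = dim_row (A t)" "dim_col (mat_deriv I A t) = dim_col (A t)"
  by (simp_all add: mat_deriv_def)

text \<open>The block sizes are the same throughout \<open>I\<close>, so an entry at a fixed
  position comes from the same block at every \<open>s\<close>, and so does its derivative.\<close>

lemma mat_deriv_append_cols: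
  assumes "t \<in> I" "\<And>s. s \<in> I \<Longrightarrow> A s \<in> carrier_mat r c1" "\<And>s. s \<in> I \<Longrightarrow> B s \<in> carrier_mat r c2"
  shows "mat_deriv I (\<lambda>s. A s @\<^sub>c B s) t = mat_deriv I A t @\<^sub>c mat_deriv I B t"
proof -
  have dims: "dim_row (A s) = r" "dim_col (A s) = c1" "dim_row (B s) = r" "dim_col (B s) = c2"
    if "s \<in> I" for s using assms that by auto
  show ?thesis
    using dims[OF \<open>t \<in> I\<close>]
    by (auto intro!: eq_matI vector_derivative_cong_on[OF \<open>t \<in> I\<close>]
        simp: mat_deriv_def index_append_cols dims)
qed

lemma mat_deriv_append_rows:
  assumes "t \<in> I" "\<And>s. s \<in> I \<Longrightarrow> A s \<in> carrier_mat r1 c" "\<And>s. s \<in> I \<Longrightarrow> B s \<in> carrier_mat r2 c"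
  shows "mat_deriv I (\<lambda>s. A s @\<^sub>r B s) t = mat_deriv I A t @\<^sub>r mat_deriv I B t"
proof -
  have dims: "dim_row (A s) = r1" "dim_col (A s) = c" "dim_row (B s) = r2" "dim_col (B s) = c"
    if "s \<in> I" for s using assms that by auto
  show ?thesis
    using dims[OF \<open>t \<in> I\<close>]
    by (auto intro!: eq_matI vector_derivative_cong_on[OF \<open>t \<in> I\<close>]
        simp: mat_deriv_def index_append_rows dims)
qed

text \<open>At an isolated point every number is a derivative; the nontrivial filter makes the
  derivative unique and thus forces the value zero.\<close>

lemma mat_deriv_const:
  assumes "at t within I \<noteq> bot"
  shows "mat_deriv I (\<lambda>s. C) t = 0\<^sub>m (dim_row C) (dim_col C)"
  using assms by (intro eq_matI) (auto simp: mat_deriv_def intro!: vector_derivative_within)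

text \<open>A singleton has empty interior, so \<open>I\<close> is a connected set with more than
  one point, and such a set has no isolated points.\<close>

lemma at_within_interval_neq_bot:
  fixes I :: "real set"
  assumes "is_interval I" "interior I \<noteq> {}" "t \<in> I"
  shows "at t within I \<noteq> bot"
proof -
  have "I \<noteq> {x}" for x using assms(2) by auto
  then have "t islimpt I"
    using connected_imp_perfect[of I t] is_interval_connected assms by blast
  then show ?thesis by (simp add: trivial_limit_within)
qed

section \<open>Orthonormal bases of a kernel and of its orthogonal complement\<close>

lemma orthonormal_basis_cols_gram:
  assumes "orthonormal_basis_cols n r B W"
  shows "B\<^sup>T * B = 1\<^sub>m r"
  using assms by (intro eq_matI) (auto simp: orthonormal_basis_cols_def)

lemma orthonormal_basis_cols_mem:
  assumes "orthonormal_basis_cols n r B W" "j < r"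
  shows "col B j \<in> W"
proof -
  interpret vec_space "TYPE(real)" n .
  have "set (cols B) \<subseteq> carrier_vec n" "col B j \<in> set (cols B)"
    using assms by (auto simp: orthonormal_basis_cols_def cols_def)
  then show ?thesis
    using assms in_own_span[of "set (cols B)"] by (auto simp: orthonormal_basis_cols_def col_space_def)
qed

lemma mat_kernel_cols_mult:
  assumes "A \<in> carrier_mat nr n" "B \<in> carrier_mat n r" "\<And>j. j < r \<Longrightarrow> col B j \<in> mat_kernel A"
  shows "A * B = 0\<^sub>m nr r"
proof (intro eq_matI)
  fix i j assume ij: "i < dim_row (0\<^sub>m nr r)" "j < dim_col (0\<^sub>m nr r)"
  then have "A *\<^sub>v col B j = 0\<^sub>v nr" using assms by (auto simp: mat_kernel_def)
  then have "row A i \<bullet> col B j = 0"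
    using ij assms by (metis carrier_matD(1) index_mult_mat_vec index_zero_mat(2) index_zero_vec(1))
  then show "(A * B) $$ (i, j) = 0\<^sub>m nr r $$ (i, j)" using ij assms by auto
qed (use assms in auto)

lemma orthogonal_complement_cols_mult:
  fixes B C :: "real mat"
  assumes "B \<in> carrier_mat n r" "C \<in> carrier_mat n s"
    "\<And>i. i < r \<Longrightarrow> col B i \<in> W"
    "\<And>j. j < s \<Longrightarrow> col C j \<in> vec_module.orthogonal_complement n W"
  shows "C\<^sup>T * B = 0\<^sub>m s r" "B\<^sup>T * C = 0\<^sub>m r s"
proof -
  interpret vec_space "TYPE(real)" n .
  show "C\<^sup>T * B = 0\<^sub>m s r"
    using assms by (intro eq_matI) (auto simp: orthogonal_complement_def)
  then show "B\<^sup>T * C = 0\<^sub>m r s"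
    using assms transpose_mult[of "C\<^sup>T" s n B r] by auto
qed

text \<open>Side by side, \<open>B\<close> and \<open>C\<close> form a square matrix whose transpose
  is a left inverse. For square matrices a left inverse is also a right inverse, and expanding that
  product by blocks gives the sum.\<close>

lemma orthonormal_completeness:
  fixes B C :: "'a::field mat"
  assumes B: "B \<in> carrier_mat (r + s) r" and C: "C \<in> carrier_mat (r + s) s"
    and "B\<^sup>T * B = 1\<^sub>m r" "C\<^sup>T * C = 1\<^sub>m s" "B\<^sup>T * C = 0\<^sub>m r s" "C\<^sup>T * B = 0\<^sub>m s r"
  shows "B * B\<^sup>T + C * C\<^sup>T = 1\<^sub>m (r + s)"
proof -
  let ?Q = "B @\<^sub>c C"
  have "?Q\<^sup>T * ?Q = 1\<^sub>m (r + s)"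
    using assms by (simp add: transpose_append_cols append_rows_mult mult_append_cols
        append_cols_append_rows one_append)
  moreover have Q: "?Q \<in> carrier_mat (r + s) (r + s)" using B C by auto
  ultimately have "?Q * ?Q\<^sup>T = 1\<^sub>m (r + s)"
    by (intro mat_mult_left_right_inverse[of "?Q\<^sup>T"]) auto
  then show ?thesis using B C by (simp add: transpose_append_cols append_cols_mult_append_rows)
qed



section \<open>Zero patterns of three-by-three and five-by-five block matrices\<close>

lemma block_upper_triangular_append:
  assumes carr: "A \<in> carrier_mat n n" "B \<in> carrier_mat n n" "C \<in> carrier_mat n n"
    "D \<in> carrier_mat n n" "E \<in> carrier_mat n n" "G \<in> carrier_mat n n"
  shows "block_upper_triangular n
    (A @\<^sub>c B @\<^sub>c C @\<^sub>r 0\<^sub>m n n @\<^sub>c D @\<^sub>c E @\<^sub>r 0\<^sub>m n n @\<^sub>c 0\<^sub>m n n @\<^sub>c G)"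
    (is "block_upper_triangular n ?M")
proof -
  note dims = carr[THEN carrier_matD(1)] carr[THEN carrier_matD(2)]
  have "?M \<in> carrier_mat (3 * n) (3 * n)"
    by (rule carrier_matI) (simp_all add: dims)
  moreover have "block n p q ?M = 0\<^sub>m n n" if "p < 3" "q < p" for p q
  proof -
    have "p = 1 \<and> q = 0 \<or> p = 2 \<and> q = 0 \<or> p = 2 \<and> q = 1"
      using that by arith
    then show ?thesis
      by (elim disjE conjE) (simp_all only: block_append[OF carr(1,2,3) zero_carrier_mat carr(4,5)
            zero_carrier_mat zero_carrier_mat carr(6)])
  qed
  ultimately show ?thesis by (simp add: block_upper_triangular_def)
qed

text \<open>The cut falls after the second strip: the first two strips carry the differential part,
  of size \<open>n1 + n2\<close>, and the last three the algebraic part.\<close>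

lemma five_by_five_blocks:
  fixes x11 :: "'a::zero mat"
  assumes carr: "x11 \<in> carrier_mat n1 n1" "x12 \<in> carrier_mat n1 n2" "x13 \<in> carrier_mat n1 \<theta>"
    "x14 \<in> carrier_mat n1 \<theta>" "x15 \<in> carrier_mat n1 \<theta>"
    "x21 \<in> carrier_mat n2 n1" "x22 \<in> carrier_mat n2 n2" "x23 \<in> carrier_mat n2 \<theta>"
    "x24 \<in> carrier_mat n2 \<theta>" "x25 \<in> carrier_mat n2 \<theta>"
    "x31 \<in> carrier_mat \<theta> n1" "x32 \<in> carrier_mat \<theta> n2" "x33 \<in> carrier_mat \<theta> \<theta>"
    "x34 \<in> carrier_mat \<theta> \<theta>" "x35 \<in> carrier_mat \<theta> \<theta>"
    "x41 \<in> carrier_mat \<theta> n1" "x42 \<in> carrier_mat \<theta> n2" "x43 \<in> carrier_mat \<theta> \<theta>"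
    "x44 \<in> carrier_mat \<theta> \<theta>" "x45 \<in> carrier_mat \<theta> \<theta>"
    "x51 \<in> carrier_mat \<theta> n1" "x52 \<in> carrier_mat \<theta> n2" "x53 \<in> carrier_mat \<theta> \<theta>"
    "x54 \<in> carrier_mat \<theta> \<theta>" "x55 \<in> carrier_mat \<theta> \<theta>"
  shows
    "   x11 @\<^sub>c x12 @\<^sub>c x13 @\<^sub>c x14 @\<^sub>c x15
     @\<^sub>r x21 @\<^sub>c x22 @\<^sub>c x23 @\<^sub>c x24 @\<^sub>c x25
     @\<^sub>r x31 @\<^sub>c x32 @\<^sub>c x33 @\<^sub>c x34 @\<^sub>c x35
     @\<^sub>r x41 @\<^sub>c x42 @\<^sub>c x43 @\<^sub>c x44 @\<^sub>c x45
     @\<^sub>r x51 @\<^sub>c x52 @\<^sub>c x53 @\<^sub>c x54 @\<^sub>c x55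
     = four_block_mat
         (x11 @\<^sub>c x12 @\<^sub>r x21 @\<^sub>c x22)
         (x13 @\<^sub>c x14 @\<^sub>c x15 @\<^sub>r x23 @\<^sub>c x24 @\<^sub>c x25)
         (x31 @\<^sub>c x32 @\<^sub>r x41 @\<^sub>c x42 @\<^sub>r x51 @\<^sub>c x52)
         (x33 @\<^sub>c x34 @\<^sub>c x35 @\<^sub>r x43 @\<^sub>c x44 @\<^sub>c x45 @\<^sub>r x53 @\<^sub>c x54 @\<^sub>c x55)"
  by (simp add: carr[THEN carrier_matD(1)] carr[THEN carrier_matD(2)] four_block_mat_append append_cols_append_rows append_cols_assoc append_rows_assoc)

text \<open>Isolates the zero pattern behind \<open>PreSCF\<close>. The zeros in the last three
  columns of strips four and five make \<open>F22\<close> triangular; those of strip two and those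
  in the first two columns of strips four and five make \<open>F21 * F12\<close> triangular.\<close>

lemma block_upper_triangular_five_by_five:
  fixes x11 :: "real mat"
  assumes F: "F =
        x11       @\<^sub>c x12       @\<^sub>c x13      @\<^sub>c x14      @\<^sub>c x15
     @\<^sub>r x21       @\<^sub>c x22       @\<^sub>c 0\<^sub>m n2 \<theta> @\<^sub>c 0\<^sub>m n2 \<theta> @\<^sub>c x25
     @\<^sub>r x31       @\<^sub>c x32       @\<^sub>c x33      @\<^sub>c x34      @\<^sub>c x35
     @\<^sub>r 0\<^sub>m \<theta> n1 @\<^sub>c x42       @\<^sub>c 0\<^sub>m \<theta> \<theta>  @\<^sub>c x44      @\<^sub>c x45
     @\<^sub>r 0\<^sub>m \<theta> n1 @\<^sub>c 0\<^sub>m \<theta> n2 @\<^sub>c 0\<^sub>m \<theta> \<theta>  @\<^sub>c 0\<^sub>m \<theta> \<theta>  @\<^sub>c x55"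
    and carr: "x11 \<in> carrier_mat n1 n1" "x12 \<in> carrier_mat n1 n2" "x13 \<in> carrier_mat n1 \<theta>"
    "x14 \<in> carrier_mat n1 \<theta>" "x15 \<in> carrier_mat n1 \<theta>"
    "x21 \<in> carrier_mat n2 n1" "x22 \<in> carrier_mat n2 n2" "x25 \<in> carrier_mat n2 \<theta>"
    "x31 \<in> carrier_mat \<theta> n1" "x32 \<in> carrier_mat \<theta> n2" "x33 \<in> carrier_mat \<theta> \<theta>"
    "x34 \<in> carrier_mat \<theta> \<theta>" "x35 \<in> carrier_mat \<theta> \<theta>"
    "x42 \<in> carrier_mat \<theta> n2" "x44 \<in> carrier_mat \<theta> \<theta>" "x45 \<in> carrier_mat \<theta> \<theta>"
    "x55 \<in> carrier_mat \<theta> \<theta>"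
  obtains F11 F12 F21 F22 where
    "F \<in> carrier_mat (n1 + n2 + 3 * \<theta>) (n1 + n2 + 3 * \<theta>)"
    "split_block F (n1 + n2) (n1 + n2) = (F11, F12, F21, F22)"
    "F22 \<in> carrier_mat (3 * \<theta>) (3 * \<theta>)"
    "block_upper_triangular \<theta> F22" "block_upper_triangular \<theta> (F21 * F12)"
    "block \<theta> 0 0 F22 = x33" "block \<theta> 1 1 F22 = x44" "block \<theta> 2 2 F22 = x55"
    "det F22 = det x33 * det x44 * det x55"
proof
  note dims = carr[THEN carrier_matD(1)] carr[THEN carrier_matD(2)]
  let ?F11 = "x11 @\<^sub>c x12 @\<^sub>r x21 @\<^sub>c x22"
  let ?F12 = "x13 @\<^sub>c x14 @\<^sub>c x15 @\<^sub>r 0\<^sub>m n2 \<theta> @\<^sub>c 0\<^sub>m n2 \<theta> @\<^sub>c x25"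
  let ?F21 = "x31 @\<^sub>c x32 @\<^sub>r 0\<^sub>m \<theta> n1 @\<^sub>c x42 @\<^sub>r 0\<^sub>m \<theta> n1 @\<^sub>c 0\<^sub>m \<theta> n2"
  let ?F22 = "x33 @\<^sub>c x34 @\<^sub>c x35 @\<^sub>r 0\<^sub>m \<theta> \<theta> @\<^sub>c x44 @\<^sub>c x45 @\<^sub>r 0\<^sub>m \<theta> \<theta> @\<^sub>c 0\<^sub>m \<theta> \<theta> @\<^sub>c x55"
  have F4: "F = four_block_mat ?F11 ?F12 ?F21 ?F22"
    unfolding F by (rule five_by_five_blocks) (rule carr zero_carrier_mat)+
  show "F \<in> carrier_mat (n1 + n2 + 3 * \<theta>) (n1 + n2 + 3 * \<theta>)"
    by (rule carrier_matI) (simp_all add: F dims)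
  show "split_block F (n1 + n2) (n1 + n2) = (?F11, ?F12, ?F21, ?F22)"
    unfolding F4
    by (rule split_block_four_block_mat, rule carrier_matI) (simp_all add: dims)
  show "?F22 \<in> carrier_mat (3 * \<theta>) (3 * \<theta>)"
    by (rule carrier_matI) (simp_all add: dims)
  show "block_upper_triangular \<theta> ?F22"
    by (rule block_upper_triangular_append) (rule carr)+
  \<comment> \<open>The second block row of \<open>?F21\<close> meets only the second strip of
    \<open>?F12\<close>, whose first two blocks are zero, and the third block row of
    \<open>?F21\<close> is zero.\<close>
  have "?F21 * ?F12
      = (x31 * x13) @\<^sub>c (x31 * x14) @\<^sub>c (x31 * x15 + x32 * x25)
     @\<^sub>r 0\<^sub>m \<theta> \<theta> @\<^sub>c 0\<^sub>m \<theta> \<theta> @\<^sub>c (x42 * x25)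
     @\<^sub>r 0\<^sub>m \<theta> \<theta> @\<^sub>c 0\<^sub>m \<theta> \<theta> @\<^sub>c 0\<^sub>m \<theta> \<theta>"
    by (simp add: dims block_algebra zero_append_cols)
  also have "block_upper_triangular \<theta> \<dots>"
    by (rule block_upper_triangular_append) (rule carrier_matI; simp add: dims)+
  finally show "block_upper_triangular \<theta> (?F21 * ?F12)" .
  note blocks = block_append[OF carr(11,12,13) zero_carrier_mat carr(15,16) zero_carrier_mat zero_carrier_mat carr(17)]
  show "block \<theta> 0 0 ?F22 = x33" "block \<theta> 1 1 ?F22 = x44" "block \<theta> 2 2 ?F22 = x55"
    by (rule blocks)+
  show "det ?F22 = det x33 * det x44 * det x55"
    by (rule det_block_upper_triangular) (rule carr)+
qed

text \<open>The pattern of $K_0$ ($Z = I$) and of its derivative ($Z = 0$).\<close>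
definition K_blocks ::
  "nat \<Rightarrow> nat \<Rightarrow> nat \<Rightarrow> real mat \<Rightarrow> real mat \<Rightarrow> real mat \<Rightarrow> real mat \<Rightarrow> real mat \<Rightarrow> real mat" where
  "K_blocks m1 m2 \<theta> X2 X3 Z Y2 Y3 =
      X2               @\<^sub>c 0\<^sub>m m1 (m2 - \<theta>) @\<^sub>c 0\<^sub>m m1 \<theta> @\<^sub>c Y2      @\<^sub>c 0\<^sub>m m1 \<theta>
   @\<^sub>r 0\<^sub>m m2 (m1 - \<theta>) @\<^sub>c X3              @\<^sub>c 0\<^sub>m m2 \<theta> @\<^sub>c 0\<^sub>m m2 \<theta> @\<^sub>c Y3
   @\<^sub>r 0\<^sub>m \<theta> (m1 - \<theta>)  @\<^sub>c 0\<^sub>m \<theta> (m2 - \<theta>)   @\<^sub>c Z       @\<^sub>c 0\<^sub>m \<theta> \<theta>  @\<^sub>c 0\<^sub>m \<theta> \<theta>"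

lemma K_0_eq_K_blocks:
  "K_0 m1 m2 \<theta> Bd3 Ba3
    = K_blocks m1 m2 \<theta> (B_d2 m1 m2 \<theta> Bd3) Bd3 (1\<^sub>m \<theta>) (B_a2 m1 m2 \<theta> Ba3) Ba3"
  by (simp add: K_0_def K_blocks_def Let_def)

text \<open>Differentiation acts block by block, and the constant blocks, \<open>Z\<close> among
  them, contribute zero. Hence the pattern survives.\<close>

lemma mat_deriv_K_blocks:
  assumes t: "t \<in> I" and nb: "at t within I \<noteq> bot"
    and carr: "\<And>s. s \<in> I \<Longrightarrow> X2 s \<in> carrier_mat m1 (m1 - \<theta>)"
    "\<And>s. s \<in> I \<Longrightarrow> X3 s \<in> carrier_mat m2 (m2 - \<theta>)"
    "\<And>s. s \<in> I \<Longrightarrow> Y2 s \<in> carrier_mat m1 \<theta>"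
    "\<And>s. s \<in> I \<Longrightarrow> Y3 s \<in> carrier_mat m2 \<theta>"
    "Z \<in> carrier_mat \<theta> \<theta>"
  shows "mat_deriv I (\<lambda>s. K_blocks m1 m2 \<theta> (X2 s) (X3 s) Z (Y2 s) (Y3 s)) t
    = K_blocks m1 m2 \<theta> (mat_deriv I X2 t) (mat_deriv I X3 t) (0\<^sub>m \<theta> \<theta>) (mat_deriv I Y2 t) (mat_deriv I Y3 t)"
proof -
  note dims = carr[THEN carrier_matD(1)] carr[THEN carrier_matD(2)]
  note cols = mat_deriv_append_cols[OF t carrier_matI carrier_matI]
  note rows = mat_deriv_append_rows[OF t carrier_matI carrier_matI]
  show ?thesis
    unfolding K_blocks_def
    by (simp add: cols rows dims mat_deriv_const[OF nb] zero_append_cols)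
qed

section \<open>The transformation at one fixed parameter value\<close>

context
  fixes m1 m2 \<theta> :: nat and Bd3 Ba3 :: "real mat"
  assumes le: "\<theta> \<le> m2" "m2 \<le> m1"
    and Bd3: "Bd3 \<in> carrier_mat m2 (m2 - \<theta>)" and Ba3: "Ba3 \<in> carrier_mat m2 \<theta>"
    and gram: "Bd3\<^sup>T * Bd3 = 1\<^sub>m (m2 - \<theta>)" "Ba3\<^sup>T * Ba3 = 1\<^sub>m \<theta>"
      "Bd3\<^sup>T * Ba3 = 0\<^sub>m (m2 - \<theta>) \<theta>" "Ba3\<^sup>T * Bd3 = 0\<^sub>m \<theta> (m2 - \<theta>)"
begin

abbreviation (input) "Bd2 \<equiv> B_d2 m1 m2 \<theta> Bd3"
abbreviation (input) "Ba2 \<equiv> B_a2 m1 m2 \<theta> Ba3"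

lemma dim_orthonormal_blocks [simp]:
  "dim_row Bd3 = m2" "dim_col Bd3 = m2 - \<theta>" "dim_row Ba3 = m2" "dim_col Ba3 = \<theta>"
  "dim_row Bd2 = m1" "dim_col Bd2 = m1 - \<theta>" "dim_row Ba2 = m1" "dim_col Ba2 = \<theta>"
  "dim_row (I_0 m2 m1) = m2" "dim_col (I_0 m2 m1) = m1"
  using Bd3 Ba3 le by (auto simp: B_d2_def B_a2_def I_0_def)

text \<open>Matches the two block columns of \<open>Bd2\<close>, so that unit and zero matrices of
  this size can be cut accordingly.\<close>

lemma m1_minus_theta: "m1 - \<theta> = (m2 - \<theta>) + (m1 - m2)"
  using le by simp

text \<open>Padding with zero rows leaves scalar products unchanged, and the columns through the
  added unit block are orthonormal and orthogonal to the padded ones.\<close>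

lemma gram2:
  "Bd2\<^sup>T * Bd2 = 1\<^sub>m (m1 - \<theta>)" "Ba2\<^sup>T * Ba2 = 1\<^sub>m \<theta>"
  "Bd2\<^sup>T * Ba2 = 0\<^sub>m (m1 - \<theta>) \<theta>" "Ba2\<^sup>T * Bd2 = 0\<^sub>m \<theta> (m1 - \<theta>)"
  unfolding m1_minus_theta one_append
  by (simp_all add: B_d2_def B_a2_def transpose_append_cols transpose_append_rows block_algebra
      append_cols_append_rows gram zero_append_cols zero_append_rows)

text \<open>Multiplication by \<open>I_0\<close> appends zero columns, the transposed form of the
  zero rows of \<open>Ba2\<close>. With \<open>gram2\<close>, this produces the zero block and the
  unit block in strip four of the transformed \<open>H_F\<close>.\<close>

lemma B_a2_transpose: "Ba3\<^sup>T * I_0 m2 m1 = Ba2\<^sup>T"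
  by (simp add: I_0_def B_a2_def transpose_append_rows block_algebra)

text \<open>\<open>I_0\<close> removes the padding of \<open>Ba2\<close>, which leaves
  \<open>Bd3\<^sup>T * Ba3\<close>. This is the zero in strip two, column four, on which the
  triangularity of \<open>F21 * F12\<close> rests.\<close>

lemma Bd3_I_0_Ba2: "Bd3\<^sup>T * I_0 m2 m1 * Ba2 = 0\<^sub>m (m2 - \<theta>) \<theta>"
  by (simp add: I_0_def B_a2_def transpose_append_rows block_algebra gram)

text \<open>Every unit block is a Gram matrix. \<open>K_0\<close> places its unit block column
  before those of \<open>Ba2\<close> and \<open>Ba3\<close>, whereas \<open>L_0\<close> places the
  matching strip last; hence the Gram matrices of \<open>Ba2\<close> and \<open>Ba3\<close> land one
  block to the right of the diagonal and form the shift \<open>N_E\<close>.\<close>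

lemma L_0_H_E_K_0:
  "L_0 m1 m2 \<theta> Bd3 Ba3 * H_E m1 m2 \<theta> * K_0 m1 m2 \<theta> Bd3 Ba3
    = four_block_mat (1\<^sub>m (m1 - \<theta> + (m2 - \<theta>))) (0\<^sub>m (m1 - \<theta> + (m2 - \<theta>)) (3 * \<theta>))
        (0\<^sub>m (3 * \<theta>) (m1 - \<theta> + (m2 - \<theta>))) (N_E \<theta>)" (is "?E = four_block_mat ?I ?Z ?Z' ?N")
proof -
  have "?E =
       1\<^sub>m (m1 - \<theta>) @\<^sub>c 0\<^sub>m (m1 - \<theta>) (m2 - \<theta>) @\<^sub>c 0\<^sub>m (m1 - \<theta>) \<theta> @\<^sub>c 0\<^sub>m (m1 - \<theta>) \<theta> @\<^sub>c 0\<^sub>m (m1 - \<theta>) \<theta>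
    @\<^sub>r 0\<^sub>m (m2 - \<theta>) (m1 - \<theta>) @\<^sub>c 1\<^sub>m (m2 - \<theta>) @\<^sub>c 0\<^sub>m (m2 - \<theta>) \<theta> @\<^sub>c 0\<^sub>m (m2 - \<theta>) \<theta> @\<^sub>c 0\<^sub>m (m2 - \<theta>) \<theta>
    @\<^sub>r 0\<^sub>m \<theta> (m1 - \<theta>) @\<^sub>c 0\<^sub>m \<theta> (m2 - \<theta>) @\<^sub>c 0\<^sub>m \<theta> \<theta> @\<^sub>c 1\<^sub>m \<theta> @\<^sub>c 0\<^sub>m \<theta> \<theta>
    @\<^sub>r 0\<^sub>m \<theta> (m1 - \<theta>) @\<^sub>c 0\<^sub>m \<theta> (m2 - \<theta>) @\<^sub>c 0\<^sub>m \<theta> \<theta> @\<^sub>c 0\<^sub>m \<theta> \<theta> @\<^sub>c 1\<^sub>m \<theta>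
    @\<^sub>r 0\<^sub>m \<theta> (m1 - \<theta>) @\<^sub>c 0\<^sub>m \<theta> (m2 - \<theta>) @\<^sub>c 0\<^sub>m \<theta> \<theta> @\<^sub>c 0\<^sub>m \<theta> \<theta> @\<^sub>c 0\<^sub>m \<theta> \<theta>"
    unfolding L_0_def H_E_def K_0_def Let_def
    by (simp add: block_algebra gram gram2 zero_append_cols)
  also have "\<dots> = four_block_mat ?I ?Z ?Z' ?N"
    by (subst five_by_five_blocks)
      (auto simp: one_append zero_append_cols zero_append_rows N_E_def numeral_3_eq_3 add_ac)
  finally show ?thesis .
qed

text \<open>\<open>X2\<close>, \<open>X3\<close>, \<open>Y2\<close>, \<open>Y3\<close> stand for the
  derivative blocks of \<open>K_0\<close>. Their terms enter columns one and four of strips one and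
  three, and columns two and five of strips two and four: neither at a required zero nor at a
  diagonal block of \<open>F22\<close>.\<close>

lemma L_0_H_F_K_0:
  assumes "H11 \<in> carrier_mat m1 m1" "H12 \<in> carrier_mat m1 m2" "H13 \<in> carrier_mat m1 \<theta>"
    "H22 \<in> carrier_mat m2 m2" "H32 \<in> carrier_mat \<theta> m2"
    and "H32 * Bd3 = 0\<^sub>m \<theta> (m2 - \<theta>)"
    and "X2 \<in> carrier_mat m1 (m1 - \<theta>)" "X3 \<in> carrier_mat m2 (m2 - \<theta>)"
      "Y2 \<in> carrier_mat m1 \<theta>" "Y3 \<in> carrier_mat m2 \<theta>"
  shows "L_0 m1 m2 \<theta> Bd3 Ba3 * H_F m1 m2 \<theta> H11 H12 H13 H22 H32 * K_0 m1 m2 \<theta> Bd3 Ba3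
      + L_0 m1 m2 \<theta> Bd3 Ba3 * H_E m1 m2 \<theta> * K_blocks m1 m2 \<theta> X2 X3 (0\<^sub>m \<theta> \<theta>) Y2 Y3 =
       (Bd2\<^sup>T * H11 * Bd2 + Bd2\<^sup>T * X2) @\<^sub>c (Bd2\<^sup>T * H12 * Bd3)
         @\<^sub>c (Bd2\<^sup>T * H13) @\<^sub>c (Bd2\<^sup>T * H11 * Ba2 + Bd2\<^sup>T * Y2) @\<^sub>c (Bd2\<^sup>T * H12 * Ba3)
    @\<^sub>r (Bd3\<^sup>T * I_0 m2 m1 * Bd2) @\<^sub>c (Bd3\<^sup>T * H22 * Bd3 + Bd3\<^sup>T * X3)
         @\<^sub>c 0\<^sub>m (m2 - \<theta>) \<theta> @\<^sub>c 0\<^sub>m (m2 - \<theta>) \<theta> @\<^sub>c (Bd3\<^sup>T * H22 * Ba3 + Bd3\<^sup>T * Y3)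
    @\<^sub>r (Ba2\<^sup>T * H11 * Bd2 + Ba2\<^sup>T * X2) @\<^sub>c (Ba2\<^sup>T * H12 * Bd3)
         @\<^sub>c (Ba2\<^sup>T * H13) @\<^sub>c (Ba2\<^sup>T * H11 * Ba2 + Ba2\<^sup>T * Y2) @\<^sub>c (Ba2\<^sup>T * H12 * Ba3)
    @\<^sub>r 0\<^sub>m \<theta> (m1 - \<theta>) @\<^sub>c (Ba3\<^sup>T * H22 * Bd3 + Ba3\<^sup>T * X3)
         @\<^sub>c 0\<^sub>m \<theta> \<theta> @\<^sub>c 1\<^sub>m \<theta> @\<^sub>c (Ba3\<^sup>T * H22 * Ba3 + Ba3\<^sup>T * Y3)
    @\<^sub>r 0\<^sub>m \<theta> (m1 - \<theta>) @\<^sub>c 0\<^sub>m \<theta> (m2 - \<theta>) @\<^sub>c 0\<^sub>m \<theta> \<theta> @\<^sub>c 0\<^sub>m \<theta> \<theta> @\<^sub>c (H32 * Ba3)"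
  unfolding L_0_def H_F_def H_E_def K_0_def K_blocks_def Let_def
  by (simp add: assms(6) assms(1-5,7-)[THEN carrier_matD(1)] assms(1-5,7-)[THEN carrier_matD(2)]
      block_algebra gram gram2 B_a2_transpose Bd3_I_0_Ba2)

lemma H32_I_0_H13_factorization:
  assumes H32: "H32 \<in> carrier_mat \<theta> m2" and H13: "H13 \<in> carrier_mat m1 \<theta>"
    and "H32 * Bd3 = 0\<^sub>m \<theta> (m2 - \<theta>)"
  shows "H32 * I_0 m2 m1 * H13 = (H32 * Ba3) * (Ba2\<^sup>T * H13)"
proof -
  have [simp]: "dim_row H32 = \<theta>" "dim_col H32 = m2" "dim_row H13 = m1"
    using H32 H13 by auto
  have "Bd3 * Bd3\<^sup>T + Ba3 * Ba3\<^sup>T = 1\<^sub>m m2"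
    using orthonormal_completeness[of Bd3 "m2 - \<theta>" \<theta> Ba3] Bd3 Ba3 gram le by simp
  then have "H32 = H32 * (Bd3 * Bd3\<^sup>T + Ba3 * Ba3\<^sup>T)"
    using H32 by simp
  also have "\<dots> = H32 * (Bd3 * Bd3\<^sup>T) + H32 * (Ba3 * Ba3\<^sup>T)"
    by (rule mult_add_distrib_mat[OF H32]) (rule carrier_matI; simp)+
  also have "H32 * (Bd3 * Bd3\<^sup>T) = 0\<^sub>m \<theta> m2"
    using assms(3) by (simp add: block_algebra flip: mult_mat_assoc)
  also have "0\<^sub>m \<theta> m2 + H32 * (Ba3 * Ba3\<^sup>T) = H32 * Ba3 * Ba3\<^sup>T"
    by (simp add: block_algebra mult_mat_assoc)
  finally have "H32 * I_0 m2 m1 * H13 = H32 * Ba3 * Ba3\<^sup>T * I_0 m2 m1 * H13"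
    by (rule arg_cong[of _ _ "\<lambda>X. X * I_0 m2 m1 * H13"])
  \<comment> \<open>Once \<open>Ba2\<^sup>T\<close> is replaced by
    \<open>Ba3\<^sup>T * I_0 m2 m1\<close>, the two sides differ only by bracketing.\<close>
  then show ?thesis
    by (simp add: mult_mat_assoc flip: B_a2_transpose)
qed

text \<open>With arbitrary matrices of the right shape in place of the derivative blocks, the
  conclusions for a fixed parameter value become pure matrix algebra.\<close>

lemma transformed_pencil_blocks:
  assumes H: "H11 \<in> carrier_mat m1 m1" "H12 \<in> carrier_mat m1 m2" "H13 \<in> carrier_mat m1 \<theta>"
    "H22 \<in> carrier_mat m2 m2" "H32 \<in> carrier_mat \<theta> m2"
    and ker: "H32 * Bd3 = 0\<^sub>m \<theta> (m2 - \<theta>)"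
    and X: "X2 \<in> carrier_mat m1 (m1 - \<theta>)" "X3 \<in> carrier_mat m2 (m2 - \<theta>)"
      "Y2 \<in> carrier_mat m1 \<theta>" "Y3 \<in> carrier_mat m2 \<theta>"
    and inv: "invertible_mat (H32 * I_0 m2 m1 * H13)"
    and d: "d = (m1 - \<theta>) + (m2 - \<theta>)"
    and F: "F = L_0 m1 m2 \<theta> Bd3 Ba3 * H_F m1 m2 \<theta> H11 H12 H13 H22 H32 * K_0 m1 m2 \<theta> Bd3 Ba3
      + L_0 m1 m2 \<theta> Bd3 Ba3 * H_E m1 m2 \<theta> * K_blocks m1 m2 \<theta> X2 X3 (0\<^sub>m \<theta> \<theta>) Y2 Y3"
  obtains F11 F12 F21 F22 where
    "F \<in> carrier_mat (d + 3 * \<theta>) (d + 3 * \<theta>)"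
    "split_block F d d = (F11, F12, F21, F22)"
    "block_upper_triangular \<theta> F22" "block_upper_triangular \<theta> (F21 * F12)"
    "invertible_mat F22"
    "block \<theta> 0 0 F22 = Ba2\<^sup>T * H13" "block \<theta> 1 1 F22 = 1\<^sub>m \<theta>" "block \<theta> 2 2 F22 = H32 * Ba3"
    "\<forall>p<3. invertible_mat (block \<theta> p p F22)"
proof -
  note [simp] = H[THEN carrier_matD(1)] H[THEN carrier_matD(2)] X[THEN carrier_matD(1)] X[THEN carrier_matD(2)]
  have carr: "Ba2\<^sup>T * H13 \<in> carrier_mat \<theta> \<theta>" "H32 * Ba3 \<in> carrier_mat \<theta> \<theta>"
    "H32 * I_0 m2 m1 * H13 \<in> carrier_mat \<theta> \<theta>"
    by (rule carrier_matI; simp)+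
  \<comment> \<open>Both factors are square of order \<theta>, so the determinant of the nonsingular
    product splits and neither factor can have determinant zero.\<close>
  have "det (H32 * Ba3) * det (Ba2\<^sup>T * H13) \<noteq> 0"
    using inv invertible_mat_iff_det[OF carr(3)] H32_I_0_H13_factorization[OF H(5,3) ker]
      det_mult[OF carr(2,1)] by simp
  then have nz: "det (Ba2\<^sup>T * H13) \<noteq> 0" "det (H32 * Ba3) \<noteq> 0" by auto
  have inv_diag: "invertible_mat (Ba2\<^sup>T * H13)" "invertible_mat (1\<^sub>m \<theta> :: real mat)"
    "invertible_mat (H32 * Ba3)"
    using nz by (simp_all add: invertible_mat_iff_det[OF carr(1)] invertible_mat_iff_det[OF carr(2)]
        invertible_mat_iff_det[OF one_carrier_mat])
  note F5 = F[unfolded L_0_H_F_K_0[OF H ker X]]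
  obtain F11 F12 F21 F22 where *:
    "F \<in> carrier_mat (d + 3 * \<theta>) (d + 3 * \<theta>)"
    "split_block F d d = (F11, F12, F21, F22)"
    "F22 \<in> carrier_mat (3 * \<theta>) (3 * \<theta>)"
    "block_upper_triangular \<theta> F22" "block_upper_triangular \<theta> (F21 * F12)"
    "block \<theta> 0 0 F22 = Ba2\<^sup>T * H13" "block \<theta> 1 1 F22 = 1\<^sub>m \<theta>" "block \<theta> 2 2 F22 = H32 * Ba3"
    "det F22 = det (Ba2\<^sup>T * H13) * det (1\<^sub>m \<theta> :: real mat) * det (H32 * Ba3)"
    unfolding d by (rule block_upper_triangular_five_by_five[OF F5]) (rule carrier_matI; simp)+
  have "invertible_mat (block \<theta> p p F22)" if "p < 3" for p
  proof -
    have "p = 0 \<or> p = 1 \<or> p = 2" using that by arith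
    then show ?thesis
      using inv_diag by (elim disjE) (simp_all only: *(6-8))
  qed
  moreover have "invertible_mat F22"
    using nz *(9) by (simp add: invertible_mat_iff_det[OF *(3)])
  ultimately show ?thesis using that * by blast
qed

end

section \<open>Passage from fixed parameter values to functions on the interval\<close>

theorem mainTheorem5:
  fixes I :: "real set"
    and m1 m2 m3 k l :: nat
    and H11 H12 H13 H22 H32 Bd3 Ba3 :: "real \<Rightarrow> real mat"
  defines "\<theta> \<equiv> m3"
    and "m \<equiv> m1 + m2 + m3"
    and "d \<equiv> m1 + m2 - 2 * m3"
    and "L0 \<equiv> (\<lambda>t. L_0 m1 m2 m3 (Bd3 t) (Ba3 t))"
    and "K0 \<equiv> (\<lambda>t. K_0 m1 m2 m3 (Bd3 t) (Ba3 t))"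
    and "HE \<equiv> H_E m1 m2 m3"
    and "HF \<equiv> (\<lambda>t. H_F m1 m2 m3 (H11 t) (H12 t) (H13 t) (H22 t) (H32 t))"
  defines "a \<equiv> 3 * \<theta>"
    and "E0 \<equiv> (\<lambda>t. L0 t * HE * K0 t)"
    and "F0 \<equiv> (\<lambda>t. L0 t * HF t * K0 t + L0 t * HE * mat_deriv I K0 t)"
  assumes "is_interval I" and "interior I \<noteq> {}"
    and "m1 \<ge> m2" and "m2 \<ge> m3" and "m3 > 0"
    and "mat_Ck_on k I m1 m1 H11"
    and "mat_Ck_on k I m1 m2 H12"
    and "mat_Ck_on k I m1 m3 H13"
    and "mat_Ck_on k I m2 m2 H22"
    and "mat_Ck_on k I m3 m2 H32"
    and "\<And>t. t \<in> I \<Longrightarrow> invertible_mat (H32 t * I_0 m2 m1 * H13 t)"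
    and "l \<ge> 1"
    and "mat_Ck_on l I m2 (m2 - \<theta>) Bd3"
    and "mat_Ck_on l I m2 \<theta> Ba3"
    and "\<And>t. t \<in> I \<Longrightarrow> orthonormal_basis_cols m2 (m2 - \<theta>) (Bd3 t) (mat_kernel (H32 t))"
    and "\<And>t. t \<in> I \<Longrightarrow> orthonormal_basis_cols m2 \<theta> (Ba3 t)
           (vec_module.orthogonal_complement m2 (mat_kernel (H32 t)))"
  shows "m = d + a \<and>
    (\<forall>t\<in>I. E0 t = four_block_mat (1\<^sub>m d) (0\<^sub>m d a) (0\<^sub>m a d) (N_E \<theta>)) \<and>
    PreSCF I d \<theta> E0 F0 \<and>
    (\<forall>t\<in>I. let (F11, F12, F21, F22) = split_block (F0 t) d d in
       block_upper_triangular \<theta> F22 \<and>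
       block \<theta> 0 0 F22 = transpose_mat (B_a2 m1 m2 \<theta> (Ba3 t)) * H13 t \<and>
       block \<theta> 1 1 F22 = 1\<^sub>m \<theta> \<and>
       block \<theta> 2 2 F22 = H32 t * Ba3 t \<and>
       (\<forall>p<3. invertible_mat (block \<theta> p p F22)))"
proof -
  have le: "\<theta> \<le> m2" "m2 \<le> m1" and theta: "m3 = \<theta>"
    using \<open>m1 \<ge> m2\<close> \<open>m2 \<ge> m3\<close> by (simp_all add: \<theta>_def)
  \<comment> \<open>The subtractions are truncated; \<open>le\<close> makes each of them
    exact.\<close>
  have d: "d = (m1 - \<theta>) + (m2 - \<theta>)"
    using le by (simp add: d_def \<theta>_def)
  have carr: "H11 t \<in> carrier_mat m1 m1" "H12 t \<in> carrier_mat m1 m2" "H13 t \<in> carrier_mat m1 \<theta>"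
    "H22 t \<in> carrier_mat m2 m2" "H32 t \<in> carrier_mat \<theta> m2"
    "Bd3 t \<in> carrier_mat m2 (m2 - \<theta>)" "Ba3 t \<in> carrier_mat m2 \<theta>"
    if "t \<in> I" for t
    using \<open>mat_Ck_on k I m1 m1 H11\<close> \<open>mat_Ck_on k I m1 m2 H12\<close> \<open>mat_Ck_on k I m1 m3 H13\<close>
      \<open>mat_Ck_on k I m2 m2 H22\<close> \<open>mat_Ck_on k I m3 m2 H32\<close>
      \<open>mat_Ck_on l I m2 (m2 - \<theta>) Bd3\<close> \<open>mat_Ck_on l I m2 \<theta> Ba3\<close> that
    by (simp_all add: mat_Ck_on_def theta)
  \<comment> \<open>Naming the four blocks by existential quantifiers lets one pointwise fact serve
    both \<open>PreSCF\<close> and the explicit diagonal blocks.\<close>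
  have pointwise: "E0 t = four_block_mat (1\<^sub>m d) (0\<^sub>m d a) (0\<^sub>m a d) (N_E \<theta>) \<and>
    F0 t \<in> carrier_mat (d + a) (d + a) \<and>
    (\<exists>F11 F12 F21 F22. split_block (F0 t) d d = (F11, F12, F21, F22) \<and>
      block_upper_triangular \<theta> F22 \<and> block_upper_triangular \<theta> (F21 * F12) \<and> invertible_mat F22 \<and>
      block \<theta> 0 0 F22 = transpose_mat (B_a2 m1 m2 \<theta> (Ba3 t)) * H13 t \<and>
      block \<theta> 1 1 F22 = 1\<^sub>m \<theta> \<and>
      block \<theta> 2 2 F22 = H32 t * Ba3 t \<and>
      (\<forall>p<3. invertible_mat (block \<theta> p p F22)))"
    if t: "t \<in> I" for t
  proof -
    \<comment> \<open>These are the two orthonormal basis hypotheses; \<open>assms\<close> counts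
      the ten definitions first.\<close>
    note onb = assms(25,26)[OF t]
    have mem: "col (Bd3 t) j \<in> mat_kernel (H32 t)" if "j < m2 - \<theta>" for j
      using orthonormal_basis_cols_mem[OF onb(1) that] .
    have mem': "col (Ba3 t) j \<in> vec_module.orthogonal_complement m2 (mat_kernel (H32 t))"
      if "j < \<theta>" for j
      using orthonormal_basis_cols_mem[OF onb(2) that] .
    note gram = orthonormal_basis_cols_gram[OF onb(1)] orthonormal_basis_cols_gram[OF onb(2)]
      orthogonal_complement_cols_mult(2,1)[OF carr(6)[OF t] carr(7)[OF t] mem mem']
    note basis = le carr(6)[OF t] carr(7)[OF t] gram
    have ker: "H32 t * Bd3 t = 0\<^sub>m \<theta> (m2 - \<theta>)"
      by (rule mat_kernel_cols_mult[OF carr(5)[OF t] carr(6)[OF t] mem])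
    have B2: "B_d2 m1 m2 \<theta> (Bd3 s) \<in> carrier_mat m1 (m1 - \<theta>)"
      "B_a2 m1 m2 \<theta> (Ba3 s) \<in> carrier_mat m1 \<theta>" if "s \<in> I" for s
      using carr(6,7)[OF that] le by (auto simp: B_d2_def B_a2_def intro!: carrier_matI)
    \<comment> \<open>The derivatives of the padded bases stay unexpanded, since only their shapes
      matter; the unit block differentiates to zero because \<open>I\<close> has no isolated
      points.\<close>
    have K': "mat_deriv I K0 t = K_blocks m1 m2 \<theta>
      (mat_deriv I (\<lambda>s. B_d2 m1 m2 \<theta> (Bd3 s)) t) (mat_deriv I Bd3 t) (0\<^sub>m \<theta> \<theta>)
      (mat_deriv I (\<lambda>s. B_a2 m1 m2 \<theta> (Ba3 s)) t) (mat_deriv I Ba3 t)"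
      unfolding K0_def K_0_eq_K_blocks theta
      by (rule mat_deriv_K_blocks[OF t])
        (use at_within_interval_neq_bot[OF \<open>is_interval I\<close> \<open>interior I \<noteq> {}\<close> t] carr B2 in simp_all)
    have E: "E0 t = four_block_mat (1\<^sub>m d) (0\<^sub>m d a) (0\<^sub>m a d) (N_E \<theta>)"
      using L_0_H_E_K_0[OF basis] by (simp add: E0_def L0_def HE_def K0_def a_def d theta)
    have F: "F0 t = L_0 m1 m2 \<theta> (Bd3 t) (Ba3 t)
          * H_F m1 m2 \<theta> (H11 t) (H12 t) (H13 t) (H22 t) (H32 t) * K_0 m1 m2 \<theta> (Bd3 t) (Ba3 t)
        + L_0 m1 m2 \<theta> (Bd3 t) (Ba3 t) * H_E m1 m2 \<theta> * mat_deriv I K0 t"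
      by (simp add: F0_def L0_def HF_def HE_def K0_def theta)
    show ?thesis
      by (rule transformed_pencil_blocks[OF basis carr(1-5)[OF t] ker _ _ _ _ assms(21)[OF t] d F[unfolded K']])
        (use E carr(6,7)[OF t] B2[OF t] in \<open>auto simp: a_def\<close>)
  qed
  have "m = d + a"
    using le by (simp add: m_def d a_def \<theta>_def)
  moreover have "PreSCF I d \<theta> E0 F0"
    unfolding PreSCF_def using pointwise by (fastforce simp: a_def)
  ultimately show ?thesis
    using pointwise by fastforce
qed

end
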